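(* Let $\Xi\subset\mathbb{R}$ be an open set containing $0$, let $f\in C^4(\mathbb{R})$ be a probability density function on $\mathbb{R}$, and let $\mathcal{S}_f=\{p(\cdot;\theta)\mid\theta=(\mu,\sigma,\xi)\in\mathbb{R}\times\mathbb{R}_{>0}\times\Xi\}$ be the location-scale-shape model generated by $f$. Suppose that the moment generating function $M_f(t)=\int_{\mathbb{R}}e^{tz}f(z)\,dz$ exists (is finite) for all $t\in2\Xi=\{2\xi\mid\xi\in\Xi\}$. Then the Wasserstein score functions of $\mathcal{S}_f$ for the parameters $\mu,\sigma,\xi$ are given by the following functions (i.e. these functions satisfy the defining equations of the Wasserstein score functions): $$\Phi^W_\mu(x;\theta)=x-\mathbb{E}_\theta[X],$$ $$\Phi^W_\sigma(x;\theta)=\frac{(x-\mu)^2}{2\sigma}-\frac{V_\theta[X]+(\mathbb{E}_\theta[X]-\mu)^2}{2\sigma},$$ $$\Phi^W_\xi(x;\theta)=\begin{cases}\dfrac{\sigma^2}{\xi^3}\left(\dfrac12t^2\log t-\dfrac34t^2+t-\dfrac{\xi}{2}M_f'(2\xi)+\dfrac34M_f(2\xi)-M_f(\xi)\right),&\xi\neq0,\\[2mm]\dfrac{\sigma^2}{6}\left(\left(\dfrac{x-\mu}{\sigma}\right)^3-M_f'''(0)\right),&\xi=0,\end{cases}$$ where $t=1+\xi\frac{x-\mu}{\sigma}$, and $M_f'$ and $M_f'''$ are the first and third derivatives of $M_f$.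
   Context: Location-scale-shape model generated by $f$: for $\theta=(\mu,\sigma,\xi)$ with $\xi\neq 0$, $p(x;\theta)=\frac1\sigma\left(1+\xi\frac{x-\mu}{\sigma}\right)^{-1}f\left(\frac1\xi\log\left(1+\xi\frac{x-\mu}{\sigma}\right)\right)$ if $1+\xi\frac{x-\mu}{\sigma}>0$ and $p(x;\theta)=0$ otherwise; and, for $\xi=0$, $p(x;\theta)=\frac1\sigma f\left(\frac{x-\mu}{\sigma}\right)$. $\mathbb{E}_\theta$ and $V_\theta$ denote expectation and variance when $X\sim p(\cdot;\theta)$. Wasserstein score functions: for a parametric family of densities $p(x;\theta)$ on $\mathbb{R}$, the Wasserstein score function $\Phi^W_i(x;\theta)$ for the parameter $\theta_i$ is defined as a solution of $$\frac{\partial}{\partial x}\left(p(x;\theta)\,\frac{\partial}{\partial x}\Phi^W_i(x;\theta)\right)=-\frac{\partial}{\partial\theta_i}p(x;\theta),\qquad \mathbb{E}_\theta[\Phi^W_i(X;\theta)]=0.$$ For $\mathcal{S}_f$ the differential equation is considered on the open set $\{x: 1+\xi\frac{x-\mu}{\sigma}>0\}$. *)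

theory Defs
  imports "HOL-Probability.Probability"
begin

definition C_k :: "nat \<Rightarrow> (real \<Rightarrow> real) \<Rightarrow> bool" where
  "C_k k f \<longleftrightarrow>
     (\<forall>j<k. \<forall>x. (deriv ^^ j) f field_differentiable at x) \<and> continuous_on UNIV ((deriv ^^ k) f)"

definition prob_density_fun :: "(real \<Rightarrow> real) \<Rightarrow> bool" where
  "prob_density_fun f \<longleftrightarrow>
     (\<forall>x. 0 \<le> f x) \<and> integrable lborel f \<and> (LINT x|lborel. f x) = 1"

definition mgf :: "(real \<Rightarrow> real) \<Rightarrow> real \<Rightarrow> real" where
  "mgf f t = (LINT z|lborel. exp (t * z) * f z)"

text \<open>The parameter is the triple of location, scale and shape.\<close>

fun lss_support :: "real \<times> real \<times> real \<Rightarrow> real set" where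
  "lss_support (\<mu>, \<sigma>, \<xi>) = {x. 1 + \<xi> * ((x - \<mu>) / \<sigma>) > 0}"

fun lss_density :: "(real \<Rightarrow> real) \<Rightarrow> real \<times> real \<times> real \<Rightarrow> real \<Rightarrow> real" where
  "lss_density f (\<mu>, \<sigma>, \<xi>) x =
     (if \<xi> = 0 then 1 / \<sigma> * f ((x - \<mu>) / \<sigma>)
      else if 1 + \<xi> * ((x - \<mu>) / \<sigma>) > 0
      then 1 / \<sigma> * inverse (1 + \<xi> * ((x - \<mu>) / \<sigma>))
             * f (1 / \<xi> * ln (1 + \<xi> * ((x - \<mu>) / \<sigma>)))
      else 0)"

text \<open>
  The law with density \<open>p\<close>. Only non-negative densities are meaningful here, because
  \<^const>\<open>ennreal\<close> truncates negative values to zero.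
\<close>

definition law :: "(real \<Rightarrow> real) \<Rightarrow> real measure" where
  "law p = density lborel (\<lambda>x. ennreal (p x))"

text \<open>
  \<open>is_wasserstein_score p D \<theta> b \<Phi>\<close>: \<open>\<Phi>\<close> is a Wasserstein score function at \<open>\<theta>\<close> for the
  coordinate of the parameter in the direction of the basis vector \<open>b\<close>, with the differential
  equation considered on the open set \<open>D\<close>. The number \<open>d\<close> is the partial derivative of the
  density \<open>p \<theta> x\<close> in that coordinate; all derivatives and the expectation are required to exist.
\<close>

definition is_wasserstein_score ::
    "('a::euclidean_space \<Rightarrow> real \<Rightarrow> real) \<Rightarrow> real set \<Rightarrow> 'a \<Rightarrow> 'a \<Rightarrow> (real \<Rightarrow> real) \<Rightarrow> bool" where
  "is_wasserstein_score p D \<theta> b \<Phi> \<longleftrightarrow>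
     (\<forall>x\<in>D. \<Phi> field_differentiable at x \<and>
        (\<exists>d. ((\<lambda>h. p (\<theta> + h *\<^sub>R b) x) has_real_derivative d) (at 0) \<and>
             ((\<lambda>y. p \<theta> y * deriv \<Phi> y) has_real_derivative - d) (at x))) \<and>
     integrable (law (p \<theta>)) \<Phi> \<and> prob_space.expectation (law (p \<theta>)) \<Phi> = 0"

end

theory Submission
  imports Defs "HOL-Real_Asymp.Real_Asymp"
begin

text \<open>
  Let \<open>Q\<^sub>\<theta>\<close> be the increasing map carrying the law \<open>f\<close> to the law \<open>p(\<cdot>; \<theta>)\<close>, and \<open>z = Q\<^sub>\<theta>\<^sup>-\<^sup>1\<close>
  its inverse, so that \<open>p = z' f(z)\<close> on the support. Differentiating \<open>z\<close> in a parameter gives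
  \<open>\<partial>\<^sub>\<theta> z = - V z'\<close>, where \<open>V\<close> is the velocity \<open>\<partial>\<^sub>\<theta> Q\<^sub>\<theta>\<close> in the coordinate \<open>x\<close>; since the mixed
  derivatives of \<open>z\<close> agree, the continuity equation \<open>\<partial>\<^sub>\<theta> p = - \<partial>\<^sub>x (p V)\<close> follows, and every primitive
  \<open>\<Phi>\<close> of \<open>V\<close> solves the score equation. Substituting \<open>x = Q\<^sub>\<theta>(z)\<close> turns the means of these primitives
  into integrals of \<open>z^k exp (s z) f(z)\<close>, i.e. into derivatives of the moment generating function,
  which may be taken under the integral because \<open>2\<Xi>\<close> is open.
\<close>

subsection \<open>Derivatives of the moment generating function\<close>

text \<open>Since d|z| \<le> exp(d|z|) \<le> exp(dz) + exp(-dz), a factor z costs only an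
  arbitrarily small shift of the exponent to either side, so the tilts at \<open>t + d\<close> and
  \<open>t - d\<close> together dominate.\<close>

lemma integrable_mult_exp_tilt:
  fixes f :: "real \<Rightarrow> real"
  assumes "0 < d" and "integrable lborel (\<lambda>z. exp ((t + d) * z) * f z)"
    and "integrable lborel (\<lambda>z. exp ((t - d) * z) * f z)"
  shows "integrable lborel (\<lambda>z. exp (t * z) * (z * f z))"
proof (rule Bochner_Integration.integrable_bound)
  let ?g = "\<lambda>z. (norm (exp ((t + d) * z) * f z) + norm (exp ((t - d) * z) * f z)) / d"
  show "integrable lborel ?g"
    using assms by (intro integrable_divide Bochner_Integration.integrable_add integrable_norm)
  \<comment> \<open>Measurability of \<open>f\<close> itself is recovered by undoing one of the two
    tilts.\<close>
  have "(\<lambda>z. exp (- (t + d) * z) * (exp ((t + d) * z) * f z)) \<in> borel_measurable lborel"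
    using borel_measurable_integrable[OF assms(2)] by measurable
  also have "(\<lambda>z. exp (- (t + d) * z) * (exp ((t + d) * z) * f z)) = f"
    by (simp only: mult.assoc[symmetric] mult_exp_exp) (simp add: algebra_simps)
  finally show "(\<lambda>z. exp (t * z) * (z * f z)) \<in> borel_measurable lborel"
    by measurable
  show "AE z in lborel. norm (exp (t * z) * (z * f z)) \<le> norm (?g z)"
  proof (intro AE_I2)
    fix z :: real
    have "d * \<bar>z\<bar> \<le> exp (d * \<bar>z\<bar>)"
      using exp_ge_add_one_self[of "d * \<bar>z\<bar>"] by linarith
    also have "\<dots> \<le> exp (d * z) + exp (- d * z)"
      by (cases "z \<ge> 0") auto
    finally have "\<bar>z\<bar> \<le> (exp (d * z) + exp (- d * z)) / d"
      using \<open>0 < d\<close> by (simp add: field_simps)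
    then have "exp (t * z) * \<bar>f z\<bar> * \<bar>z\<bar> \<le> exp (t * z) * \<bar>f z\<bar> * ((exp (d * z) + exp (- d * z)) / d)"
      by (intro mult_left_mono) auto
    also have "\<dots> = ?g z"
      by (simp add: abs_mult ring_distribs exp_add exp_diff exp_minus divide_inverse add_divide_distrib)
    finally show "norm (exp (t * z) * (z * f z)) \<le> norm (?g z)"
      using \<open>0 < d\<close> by (simp add: abs_mult mult_ac)
  qed
qed

text \<open>The radius comes from a closed ball, so the bound on \<open>h\<close> is not strict and
  the endpoints \<open>t + d\<close> and \<open>t - d\<close> can themselves serve as tilts.\<close>

lemma open_real_symmetric_nbhd:
  fixes t :: real
  assumes "open S" "t \<in> S"
  obtains d where "0 < d" "\<And>h. \<bar>h\<bar> \<le> d \<Longrightarrow> t + h \<in> S"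
proof -
  obtain e where "e > 0" "cball t e \<subseteq> S"
    using assms open_contains_cball by blast
  then show thesis
    by (intro that[of e]) (auto simp: dist_real_def subset_iff)
qed

lemma integrable_mult_exp_tilt_open:
  fixes f :: "real \<Rightarrow> real"
  assumes "open S" and "\<And>s. s \<in> S \<Longrightarrow> integrable lborel (\<lambda>z. exp (s * z) * f z)" and "t \<in> S"
  shows "integrable lborel (\<lambda>z. exp (t * z) * (z * f z))"
proof -
  obtain d where d: "0 < d" "\<And>h. \<bar>h\<bar> \<le> d \<Longrightarrow> t + h \<in> S"
    using open_real_symmetric_nbhd assms by blast
  show ?thesis
    using d(1) d(2)[of d] d(2)[of "- d"] by (intro integrable_mult_exp_tilt[of d] assms(2)) auto
qed

text \<open>Both signs follow from 1 + y \<le> exp y, used at -y when y \<ge> 0 and at y otherwise.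
  The linear factor |y| later cancels the denominator of a difference quotient.\<close>

lemma abs_exp_diff_one_le: "\<bar>exp y - 1\<bar> \<le> \<bar>y\<bar> * exp \<bar>y\<bar>" for y :: real
proof (cases "y \<ge> 0")
  case True
  have "(1 - y) * exp y \<le> exp (- y) * exp y"
    using exp_ge_add_one_self[of "- y"] by (intro mult_right_mono) auto
  with True show ?thesis
    by (simp add: exp_minus algebra_simps)
next
  case False
  have "- y * 1 \<le> - y * exp \<bar>y\<bar>"
    using False by (intro mult_left_mono) auto
  moreover have "\<bar>exp y - 1\<bar> = 1 - exp y" "\<bar>y\<bar> = - y"
    using False by auto
  ultimately show ?thesis
    using exp_ge_add_one_self[of y] by (simp only: mult_1_right)
qed

text \<open>Differentiation under the integral sign by dominated convergence. The difference
  quotients in the parameter are dominated by the tilts of z f(z) at \<open>t + d\<close> and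
  \<open>t - d\<close>, which are integrable because \<open>S\<close> is open.\<close>

lemma DERIV_mgf:
  assumes "open S" and int: "\<And>s. s \<in> S \<Longrightarrow> integrable lborel (\<lambda>z. exp (s * z) * f z)" and "t \<in> S"
  shows "(mgf f has_real_derivative mgf (\<lambda>z. z * f z) t) (at t)"
proof -
  obtain d where d: "0 < d" "\<And>h. \<bar>h\<bar> \<le> d \<Longrightarrow> t + h \<in> S"
    using open_real_symmetric_nbhd assms by blast
  have S: "t + d \<in> S" "t - d \<in> S"
    using d(2)[of d] d(2)[of "- d"] d(1) by auto
  have int': "integrable lborel (\<lambda>z. exp (s * z) * (z * f z))" if "s \<in> S" for s
    using integrable_mult_exp_tilt_open[OF assms(1) int that] .
  let ?q = "\<lambda>h z. (exp ((t + h) * z) * f z - exp (t * z) * f z) / h"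
  have q: "(mgf f (t + h) - mgf f t) / h = (LINT z|lborel. ?q h z)" if "\<bar>h\<bar> < d" for h
    unfolding mgf_def using d(2)[of h] that \<open>t \<in> S\<close>
    by (simp add: int)
  \<comment> \<open>Restricting to |h| < d keeps \<open>t + h\<close> in \<open>S\<close>, so every
    integral along the sequence exists. The interval is open, hence the restricted filter is the
    full one at 0.\<close>
  have "((\<lambda>h. (mgf f (t + h) - mgf f t) / h) \<longlongrightarrow> mgf (\<lambda>z. z * f z) t) (at 0 within {-d<..<d})"
    unfolding tendsto_at_iff_sequentially
  proof (intro allI impI)
    fix X :: "nat \<Rightarrow> real"
    assume X: "\<forall>i. X i \<in> {-d<..<d} - {0}" and lim: "X \<longlonglongrightarrow> 0"
    have X': "X i \<noteq> 0" "\<bar>X i\<bar> < d" for i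
      using X[rule_format, of i] by auto
    have "(\<lambda>i. LINT z|lborel. ?q (X i) z) \<longlonglongrightarrow> (LINT z|lborel. exp (t * z) * (z * f z))"
    proof (rule integral_dominated_convergence)
      let ?w = "\<lambda>z. norm (exp ((t + d) * z) * (z * f z)) + norm (exp ((t - d) * z) * (z * f z))"
      show "(\<lambda>z. exp (t * z) * (z * f z)) \<in> borel_measurable lborel"
        using int'[OF \<open>t \<in> S\<close>] by auto
      show "?q (X i) \<in> borel_measurable lborel" for i
      proof (intro borel_measurable_integrable integrable_divide Bochner_Integration.integrable_diff int)
        show "t + X i \<in> S"
          by (intro d(2) less_imp_le X')
      qed fact
      show "integrable lborel ?w"
        by (intro Bochner_Integration.integrable_add integrable_norm int' S)
      show "AE z in lborel. (\<lambda>i. ?q (X i) z) \<longlonglongrightarrow> exp (t * z) * (z * f z)"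
      proof (intro AE_I2)
        fix z :: real
        have "((\<lambda>s. exp (s * z) * f z) has_real_derivative exp (t * z) * (z * f z)) (at t)"
          by (auto intro!: derivative_eq_intros)
        then have "((\<lambda>h. ?q h z) \<longlongrightarrow> exp (t * z) * (z * f z)) (at 0)"
          by (simp add: DERIV_def)
        then show "(\<lambda>i. ?q (X i) z) \<longlonglongrightarrow> exp (t * z) * (z * f z)"
          using X lim unfolding tendsto_at_iff_sequentially comp_def by auto
      qed
      show "AE z in lborel. norm (?q (X i) z) \<le> ?w z" for i
      proof (intro AE_I2)
        fix z :: real
        let ?h = "X i"
        have h: "?h \<noteq> 0" "\<bar>?h\<bar> \<le> d"
          using X'[of i] by auto
        \<comment> \<open>The bound becomes uniform in \<open>?h\<close>: the exponent |hz| is at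
          most d|z|, and the remaining factor |h| disappears on division.\<close>
        have "\<bar>exp (?h * z) - 1\<bar> \<le> \<bar>?h * z\<bar> * exp \<bar>?h * z\<bar>"
          by (rule abs_exp_diff_one_le)
        also have "\<dots> \<le> \<bar>?h * z\<bar> * (exp (d * z) + exp (- d * z))"
        proof (intro mult_left_mono)
          have "exp \<bar>?h * z\<bar> \<le> exp (d * \<bar>z\<bar>)"
            using h by (simp add: abs_mult mult_right_mono)
          also have "\<dots> \<le> exp (d * z) + exp (- d * z)"
            by (cases "z \<ge> 0") auto
          finally show "exp \<bar>?h * z\<bar> \<le> exp (d * z) + exp (- d * z)" .
        qed auto
        finally have "\<bar>exp (?h * z) - 1\<bar> / \<bar>?h\<bar> \<le> \<bar>z\<bar> * (exp (d * z) + exp (- d * z))"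
          using h by (simp add: field_simps abs_mult)
        then have "exp (t * z) * \<bar>f z\<bar> * (\<bar>exp (?h * z) - 1\<bar> / \<bar>?h\<bar>)
          \<le> exp (t * z) * \<bar>f z\<bar> * (\<bar>z\<bar> * (exp (d * z) + exp (- d * z)))"
          by (intro mult_left_mono) auto
        also have "\<dots> = ?w z"
          by (simp add: abs_mult ring_distribs exp_add exp_diff exp_minus divide_inverse)
        also have "exp (t * z) * \<bar>f z\<bar> * (\<bar>exp (?h * z) - 1\<bar> / \<bar>?h\<bar>)
          = \<bar>exp (t * z) * f z * (exp (?h * z) - 1) / ?h\<bar>"
          by (simp add: abs_mult)
        also have "exp (t * z) * f z * (exp (?h * z) - 1) / ?h = ?q ?h z"
          by (simp add: ring_distribs exp_add mult_ac)
        finally show "norm (?q ?h z) \<le> ?w z"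
          by simp
      qed
    qed
    moreover have "(mgf f (t + X i) - mgf f t) / X i = (LINT z|lborel. ?q (X i) z)" for i
      by (intro q X')
    ultimately show "((\<lambda>h. (mgf f (t + h) - mgf f t) / h) \<circ> X) \<longlonglongrightarrow> mgf (\<lambda>z. z * f z) t"
      by (simp only: comp_def mgf_def[of "\<lambda>z. z * f z"])
  qed
  moreover have "at 0 within {-d<..<d} = at 0"
    using \<open>0 < d\<close> by (intro at_within_open) auto
  ultimately show ?thesis
    by (simp add: DERIV_def)
qed

text \<open>Both claims go through one induction: differentiating once more applies
  \<open>DERIV_mgf\<close> to z^k f(z), which requires its tilts to be integrable on all of
  \<open>S\<close>.\<close>

lemma higher_deriv_mgf:
  assumes "open S" and "\<And>s. s \<in> S \<Longrightarrow> integrable lborel (\<lambda>z. exp (s * z) * f z)" and "t \<in> S"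
  shows "integrable lborel (\<lambda>z. exp (t * z) * (z ^ k * f z))
    \<and> (deriv ^^ k) (mgf f) t = mgf (\<lambda>z. z ^ k * f z) t"
  using assms(3)
proof (induction k arbitrary: t)
  case 0
  then show ?case
    using assms(2) by simp
next
  case (Suc k)
  have int: "integrable lborel (\<lambda>z. exp (s * z) * (z ^ k * f z))" if "s \<in> S" for s
    using Suc.IH[OF that] by simp
  have "(mgf (\<lambda>z. z ^ k * f z) has_real_derivative mgf (\<lambda>z. z * (z ^ k * f z)) t) (at t)"
    by (rule DERIV_mgf[OF \<open>open S\<close> int \<open>t \<in> S\<close>])
  \<comment> \<open>The induction hypothesis identifies the two functions on \<open>S\<close> only;
    openness of \<open>S\<close> makes this enough for their derivatives at
    \<open>t\<close>.\<close>
  then have "((deriv ^^ k) (mgf f) has_real_derivative mgf (\<lambda>z. z * (z ^ k * f z)) t) (at t)"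
    by (rule has_field_derivative_transform_within_open[OF _ \<open>open S\<close> \<open>t \<in> S\<close>])
      (use Suc.IH in simp)
  then have "(deriv ^^ Suc k) (mgf f) t = mgf (\<lambda>z. z * (z ^ k * f z)) t"
    by (simp add: DERIV_imp_deriv)
  moreover have "integrable lborel (\<lambda>z. exp (t * z) * (z * (z ^ k * f z)))"
    by (rule integrable_mult_exp_tilt_open[OF \<open>open S\<close> int \<open>t \<in> S\<close>])
  ultimately show ?case
    by (simp add: mult.assoc)
qed

subsection \<open>The location-scale-shape model as a pushforward\<close>

text \<open>This is the map z of the overview. The branch for \<xi> = 0 is the limit of the other
  one.\<close>

fun lss_coord :: "real \<times> real \<times> real \<Rightarrow> real \<Rightarrow> real" where
  "lss_coord (\<mu>, \<sigma>, \<xi>) x =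
     (if \<xi> = 0 then (x - \<mu>) / \<sigma> else ln (1 + \<xi> * ((x - \<mu>) / \<sigma>)) / \<xi>)"

text \<open>The x-derivative of \<open>lss_coord\<close> on the support. One formula covers all
  \<xi>, since it reduces to 1/\<sigma> at \<xi> = 0.\<close>

fun lss_slope :: "real \<times> real \<times> real \<Rightarrow> real \<Rightarrow> real" where
  "lss_slope (\<mu>, \<sigma>, \<xi>) x = 1 / (\<sigma> * (1 + \<xi> * ((x - \<mu>) / \<sigma>)))"

text \<open>The map Q of the overview, inverse to \<open>lss_coord\<close> on the support.\<close>

fun lss_quantile :: "real \<times> real \<times> real \<Rightarrow> real \<Rightarrow> real" where
  "lss_quantile (\<mu>, \<sigma>, \<xi>) z = \<mu> + \<sigma> * (if \<xi> = 0 then z else (exp (\<xi> * z) - 1) / \<xi>)"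

text \<open>This is p = z' f(z), which merges the cases \<xi> = 0 and \<xi> \<noteq> 0 of the
  density.\<close>

lemma lss_density_eq:
  "lss_density f \<theta> x = (if x \<in> lss_support \<theta> then lss_slope \<theta> x * f (lss_coord \<theta> x) else 0)"
  by (cases \<theta>) (auto simp: divide_inverse mult_ac)

lemma open_lss_support: "open (lss_support \<theta>)"
proof (cases \<theta>)
  case (fields \<mu> \<sigma> \<xi>)
  show ?thesis
    unfolding fields lss_support.simps divide_inverse by (intro open_Collect_less continuous_intros)
qed

lemma lss_slope_pos: "0 < fst (snd \<theta>) \<Longrightarrow> x \<in> lss_support \<theta> \<Longrightarrow> 0 < lss_slope \<theta> x"
  by (cases \<theta>) auto

lemma DERIV_lss_coord:
  assumes "0 < fst (snd \<theta>)" "x \<in> lss_support \<theta>"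
  shows "(lss_coord \<theta> has_real_derivative lss_slope \<theta> x) (at x)"
proof (cases \<theta>)
  case (fields \<mu> \<sigma> \<xi>)
  with assms have "0 < \<sigma>" "0 < 1 + \<xi> * ((x - \<mu>) / \<sigma>)"
    by auto
  then show ?thesis
    unfolding fields lss_coord.simps[abs_def] lss_slope.simps
    by (cases "\<xi> = 0") (auto intro!: derivative_eq_intros simp: divide_inverse)
qed

lemma lss_quantile_in_support: "0 < fst (snd \<theta>) \<Longrightarrow> lss_quantile \<theta> z \<in> lss_support \<theta>"
  by (cases \<theta>) (auto simp: field_simps)

lemma lss_coord_quantile: "0 < fst (snd \<theta>) \<Longrightarrow> lss_coord \<theta> (lss_quantile \<theta> z) = z"
  by (cases \<theta>) auto

lemma lss_quantile_coord:
  "0 < fst (snd \<theta>) \<Longrightarrow> x \<in> lss_support \<theta> \<Longrightarrow> lss_quantile \<theta> (lss_coord \<theta> x) = x"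
  by (cases \<theta>) auto

lemma range_lss_quantile: "0 < fst (snd \<theta>) \<Longrightarrow> range (lss_quantile \<theta>) = lss_support \<theta>"
  by (auto simp: lss_quantile_in_support) (metis lss_quantile_coord rangeI)

lemma DERIV_lss_quantile:
  assumes "0 < fst (snd \<theta>)"
  shows "(lss_quantile \<theta> has_real_derivative inverse (lss_slope \<theta> (lss_quantile \<theta> z))) (at z)"
proof (cases \<theta>)
  case (fields \<mu> \<sigma> \<xi>)
  with assms show ?thesis
    unfolding fields lss_quantile.simps[abs_def] lss_slope.simps
    by (cases "\<xi> = 0") (auto intro!: derivative_eq_intros)
qed

lemma borel_measurable_lss [measurable]:
  "lss_coord \<theta> \<in> borel_measurable borel" "lss_slope \<theta> \<in> borel_measurable borel"
  "lss_quantile \<theta> \<in> borel_measurable borel" "lss_support \<theta> \<in> sets borel"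
proof -
  obtain \<mu> \<sigma> \<xi> where [simp]: "\<theta> = (\<mu>, \<sigma>, \<xi>)"
    using prod_cases3 by blast
  show "lss_coord \<theta> \<in> borel_measurable borel" "lss_slope \<theta> \<in> borel_measurable borel"
    "lss_quantile \<theta> \<in> borel_measurable borel"
    by (simp_all add: lss_coord.simps[abs_def] lss_slope.simps[abs_def] lss_quantile.simps[abs_def])
qed (simp add: open_lss_support)

lemma lss_density_nonneg: "0 < fst (snd \<theta>) \<Longrightarrow> (\<And>z. 0 \<le> f z) \<Longrightarrow> 0 \<le> lss_density f \<theta> x"
  by (simp add: lss_density_eq lss_slope_pos less_imp_le)

text \<open>Substitute x = Q(z): the Jacobian of Q is the reciprocal of the slope and cancels the
  slope in the density, leaving g(Q(z)) f(z). The substitution theorem yields integrability along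
  with the value; it concerns absolutely integrable functions, so the proof passes from
  \<open>lborel\<close> to \<open>lebesgue\<close> and back.\<close>

lemma
  assumes "0 < fst (snd \<theta>)" and "\<And>z. 0 \<le> f z"
    and [measurable]: "f \<in> borel_measurable borel" "g \<in> borel_measurable borel"
    and int: "integrable lborel (\<lambda>z. g (lss_quantile \<theta> z) * f z)"
  shows integrable_law_lss: "integrable (law (lss_density f \<theta>)) g"
    and integral_law_lss:
      "integral\<^sup>L (law (lss_density f \<theta>)) g = (LINT z|lborel. g (lss_quantile \<theta> z) * f z)"
proof -
  let ?Q = "lss_quantile \<theta>" and ?p = "lss_density f \<theta>" and ?D = "lss_support \<theta>"
  have [measurable]: "?p \<in> borel_measurable borel"
    unfolding lss_density_eq[abs_def] by measurable
  have "g (?Q z) * f z = \<bar>inverse (lss_slope \<theta> (?Q z))\<bar> * (?p (?Q z) * g (?Q z))" for z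
    using lss_slope_pos[OF assms(1) lss_quantile_in_support[OF assms(1)], of z]
    by (simp add: lss_density_eq lss_quantile_in_support lss_coord_quantile assms(1))
  then have eq: "(\<lambda>z. g (?Q z) * f z) = (\<lambda>z. \<bar>inverse (lss_slope \<theta> (?Q z))\<bar> * (?p (?Q z) * g (?Q z)))"
    by auto
  have abs_int: "(\<lambda>z. g (?Q z) * f z) absolutely_integrable_on UNIV"
    unfolding absolutely_integrable_measurable_real
    using int by (simp add: set_integrable_def integrable_completion)
  have "inj ?Q"
    by (rule inj_on_inverseI) (rule lss_coord_quantile[OF assms(1)])
  then have *: "(\<lambda>x. ?p x * g x) absolutely_integrable_on ?D"
    "integral ?D (\<lambda>x. ?p x * g x) = integral UNIV (\<lambda>z. g (?Q z) * f z)"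
    using has_absolute_integral_change_of_variables_1'[where S=UNIV and g = ?Q
        and g' = "\<lambda>z. inverse (lss_slope \<theta> (?Q z))" and f = "\<lambda>x. ?p x * g x"]
      abs_int DERIV_lss_quantile[OF assms(1)] range_lss_quantile[OF assms(1)]
    unfolding eq by auto
  \<comment> \<open>The density vanishes off the support, so the integral over the support is the
    integral over the line.\<close>
  have restr: "(\<lambda>x. indicator ?D x *\<^sub>R (?p x * g x)) = (\<lambda>x. ?p x * g x)"
    by (auto simp: lss_density_eq indicator_def)
  have int_p: "integrable lborel (\<lambda>x. ?p x * g x)"
    using *(1) unfolding set_integrable_def restr by (simp add: integrable_completion)
  have "(LINT x|lborel. ?p x * g x) = (LINT x:?D|lebesgue. ?p x * g x)"
    unfolding set_lebesgue_integral_def restr by (simp add: integral_completion)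
  also have "\<dots> = integral UNIV (\<lambda>z. g (?Q z) * f z)"
    using *  by (simp add: set_lebesgue_integral_eq_integral)
  also have "\<dots> = (LINT z|lborel. g (?Q z) * f z)"
    using integral_lborel[OF int] by simp
  finally have I: "(LINT x|lborel. ?p x * g x) = (LINT z|lborel. g (?Q z) * f z)" .
  show "integrable (law ?p) g"
    unfolding law_def using int_p lss_density_nonneg[OF assms(1,2)]
    by (subst integrable_density) auto
  show "integral\<^sup>L (law ?p) g = (LINT z|lborel. g (?Q z) * f z)"
    unfolding law_def I[symmetric] using lss_density_nonneg[OF assms(1,2)]
    by (subst integral_density) auto
qed

subsection \<open>The score equation\<close>

text \<open>For fixed x the quantity defining the support is continuous in the parameter, as
  \<sigma> \<noteq> 0, so its positivity persists. Near h = 0 the density is therefore given by its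
  formula on the support.\<close>

lemma eventually_in_lss_support:
  assumes "0 < fst (snd \<theta>)" "x \<in> lss_support \<theta>"
  shows "\<forall>\<^sub>F h in nhds 0. x \<in> lss_support (\<theta> + h *\<^sub>R b)"
proof -
  obtain \<mu> \<sigma> \<xi> where \<theta>: "\<theta> = (\<mu>, \<sigma>, \<xi>)"
    using prod_cases3 by blast
  obtain p q r where b: "b = (p, q, r)"
    using prod_cases3 by blast
  define t where "t h = 1 + (\<xi> + h * r) * ((x - (\<mu> + h * p)) / (\<sigma> + h * q))" for h
  have "isCont t 0" "0 < t 0"
    using assms by (auto simp: \<theta> t_def[abs_def] intro!: continuous_intros)
  then have "(t \<longlongrightarrow> t 0) (nhds 0)"
    by (simp add: isCont_def tendsto_at_iff_tendsto_nhds)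
  then have "\<forall>\<^sub>F h in nhds 0. 0 < t h"
    using \<open>0 < t 0\<close> by (rule order_tendstoD)
  then show ?thesis
    by (simp add: \<theta> b t_def)
qed

text \<open>Here \<open>V\<close> is the velocity and \<open>m\<close> the common value expressing
  equality of mixed derivatives: the parameter derivative of z' is -m, while the x-derivative of V
  z' is m. The product and chain rules then give opposite values for the parameter derivative of z'
  f(z) and the x-derivative of V z' f(z). The mean is computed after the substitution x =
  Q(z).\<close>

lemma is_wasserstein_score_lss:
  assumes \<sigma>: "0 < fst (snd \<theta>)" and nonneg: "\<And>z. 0 \<le> f z"
    and f': "\<And>z. (f has_real_derivative f' z) (at z)"
    and coord: "\<And>x. x \<in> lss_support \<theta> \<Longrightarrow>
      ((\<lambda>h. lss_coord (\<theta> + h *\<^sub>R b) x) has_real_derivative - (V x * lss_slope \<theta> x)) (at 0)"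
    and slope: "\<And>x. x \<in> lss_support \<theta> \<Longrightarrow>
      ((\<lambda>h. lss_slope (\<theta> + h *\<^sub>R b) x) has_real_derivative - m x) (at 0)"
    and flux: "\<And>x. x \<in> lss_support \<theta> \<Longrightarrow>
      ((\<lambda>y. V y * lss_slope \<theta> y) has_real_derivative m x) (at x)"
    and \<Phi>: "\<And>x. x \<in> lss_support \<theta> \<Longrightarrow> (\<Phi> has_real_derivative V x) (at x)"
    and [measurable]: "\<Phi> \<in> borel_measurable borel"
    and int: "has_bochner_integral lborel (\<lambda>z. \<Phi> (lss_quantile \<theta> z) * f z) 0"
  shows "is_wasserstein_score (lss_density f) (lss_support \<theta>) \<theta> b \<Phi>"
  unfolding is_wasserstein_score_def
proof (intro conjI ballI)
  have [measurable]: "f \<in> borel_measurable borel"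
    using f' by (intro borel_measurable_continuous_onI continuous_at_imp_continuous_on)
      (auto intro: DERIV_isCont)
  show "integrable (law (lss_density f \<theta>)) \<Phi>"
    using int by (intro integrable_law_lss \<sigma> nonneg) (auto simp: has_bochner_integral_iff)
  show "integral\<^sup>L (law (lss_density f \<theta>)) \<Phi> = 0"
    using int by (subst integral_law_lss[OF \<sigma> nonneg]) (auto simp: has_bochner_integral_iff)
  fix x assume x: "x \<in> lss_support \<theta>"
  show "\<Phi> field_differentiable at x"
    using \<Phi>[OF x] by (auto simp: field_differentiable_def)
  let ?d = "- (m x * f (lss_coord \<theta> x) + V x * lss_slope \<theta> x * (f' (lss_coord \<theta> x) * lss_slope \<theta> x))"
  \<comment> \<open>The terms \<open>0 *\<^sub>R b\<close> are left in place so that the derivative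
    rules match by unification.\<close>
  have "((\<lambda>h. lss_slope (\<theta> + h *\<^sub>R b) x * f (lss_coord (\<theta> + h *\<^sub>R b) x)) has_real_derivative
      - m x * f (lss_coord (\<theta> + 0 *\<^sub>R b) x)
        + (f' (lss_coord (\<theta> + 0 *\<^sub>R b) x) * - (V x * lss_slope \<theta> x)) * lss_slope (\<theta> + 0 *\<^sub>R b) x) (at 0)"
    by (rule DERIV_mult slope x DERIV_chain2[OF f'] coord)+
  also have "- m x * f (lss_coord (\<theta> + 0 *\<^sub>R b) x)
        + (f' (lss_coord (\<theta> + 0 *\<^sub>R b) x) * - (V x * lss_slope \<theta> x)) * lss_slope (\<theta> + 0 *\<^sub>R b) x = ?d"
    by simp
  finally have "((\<lambda>h. lss_slope (\<theta> + h *\<^sub>R b) x * f (lss_coord (\<theta> + h *\<^sub>R b) x))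
      has_real_derivative ?d) (at 0)" .
  moreover have "\<forall>\<^sub>F h in nhds 0. lss_density f (\<theta> + h *\<^sub>R b) x
      = lss_slope (\<theta> + h *\<^sub>R b) x * f (lss_coord (\<theta> + h *\<^sub>R b) x)"
    using eventually_in_lss_support[OF \<sigma> x, of b] by eventually_elim (simp add: lss_density_eq)
  ultimately have param: "((\<lambda>h. lss_density f (\<theta> + h *\<^sub>R b) x) has_real_derivative ?d) (at 0)"
    by (subst DERIV_cong_ev[OF refl _ refl])
  have "((\<lambda>y. V y * lss_slope \<theta> y * f (lss_coord \<theta> y)) has_real_derivative - ?d) (at x)"
    by (rule DERIV_cong[OF DERIV_mult[OF flux[OF x] DERIV_chain2[OF f' DERIV_lss_coord[OF \<sigma> x]]]])
      (simp add: algebra_simps)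
  \<comment> \<open>The flux in the score equation is p V, because \<Phi> is a primitive of V; the
    identity holds on the open support and so can be differentiated at \<open>x\<close>.\<close>
  moreover have "V y * lss_slope \<theta> y * f (lss_coord \<theta> y) = lss_density f \<theta> y * deriv \<Phi> y"
    if "y \<in> lss_support \<theta>" for y
    using that DERIV_imp_deriv[OF \<Phi>[OF that]] by (simp add: lss_density_eq)
  ultimately have "((\<lambda>y. lss_density f \<theta> y * deriv \<Phi> y) has_real_derivative - ?d) (at x)"
    by (rule has_field_derivative_transform_within_open[OF _ open_lss_support x])
  with param show "\<exists>d. ((\<lambda>h. lss_density f (\<theta> + h *\<^sub>R b) x) has_real_derivative d) (at 0) \<and>
      ((\<lambda>y. lss_density f \<theta> y * deriv \<Phi> y) has_real_derivative - d) (at x)"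
    by blast
qed

text \<open>From ln(1 + hu)/h = u - h u^2/2 + ..., the value u at h = 0 removes the singularity.
  This is the shape derivative at \<xi> = 0, where a perturbation switches from one branch of
  \<open>lss_coord\<close> to the other.\<close>

lemma DERIV_ln_one_plus_mult_over:
  "((\<lambda>h. if h = 0 then u else ln (1 + h * u) / h) has_real_derivative - (u\<^sup>2 / 2)) (at 0)"
proof (cases "u = 0")
  case True
  then show ?thesis
    by (simp cong: if_cong)
next
  case False
  have "((\<lambda>h. (ln (1 + h * u) / h - u) / h) \<longlongrightarrow> - (u\<^sup>2 / 2)) (at 0)"
    using False unfolding power2_eq_square by real_asymp
  then show ?thesis
    unfolding DERIV_def
    by (rule Lim_transform_eventually) (auto simp: eventually_at intro!: exI[of _ 1])
qed

section \<open>Parameter and space derivatives of the coordinate and the slope\<close>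

context
  fixes \<mu> \<sigma> \<xi> x u t :: real
  defines "u \<equiv> (x - \<mu>) / \<sigma>" and "t \<equiv> 1 + \<xi> * u"
  assumes \<sigma>: "0 < \<sigma>" and t: "0 < t"
begin

text \<open>The velocity is 1, because a change of \<mu> translates Q, and the slope is
  1/(\<sigma>t).\<close>

lemma DERIV_lss_coord_location:
  "((\<lambda>h. lss_coord (\<mu> + h, \<sigma>, \<xi>) x) has_real_derivative - (1 / (\<sigma> * t))) (at 0)"
proof (cases "\<xi> = 0")
  case True
  then show ?thesis
    using \<sigma> by (auto simp: t_def intro!: derivative_eq_intros)
next
  case False
  have "((\<lambda>h. 1 + \<xi> * ((x - (\<mu> + h)) / \<sigma>)) has_real_derivative - (\<xi> / \<sigma>)) (at 0)"
    using \<sigma> by (auto intro!: derivative_eq_intros)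
  from DERIV_cdivide[OF DERIV_chain2[OF DERIV_ln_divide this], of \<xi>] show ?thesis
    using t \<sigma> False by (simp add: t_def u_def mult.commute)
qed

text \<open>The velocity is u, because Q - \<mu> is proportional to \<sigma>.\<close>

lemma DERIV_lss_coord_scale:
  "((\<lambda>h. lss_coord (\<mu>, \<sigma> + h, \<xi>) x) has_real_derivative - (u / (\<sigma> * t))) (at 0)"
proof (cases "\<xi> = 0")
  case True
  then show ?thesis
    using \<sigma>
    by (auto simp: t_def u_def power2_eq_square minus_divide_left intro!: derivative_eq_intros)
next
  case False
  have "((\<lambda>h. 1 + \<xi> * ((x - \<mu>) / (\<sigma> + h))) has_real_derivative - (\<xi> * u / \<sigma>)) (at 0)"
    using \<sigma> by (auto simp: u_def power2_eq_square intro!: derivative_eq_intros)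
  from DERIV_cdivide[OF DERIV_chain2[OF DERIV_ln_divide this], of \<xi>] show ?thesis
    using t \<sigma> False by (simp add: t_def u_def mult_ac)
qed

text \<open>With t = exp(\<xi>z), differentiating \<sigma>(exp(\<xi>z) - 1)/\<xi> in \<xi> gives the
  velocity \<sigma>(t ln t - t + 1)/\<xi>^2, whose limit at \<xi> = 0 is \<sigma>u^2/2. The claim is
  minus this velocity times the slope.\<close>

lemma DERIV_lss_coord_shape:
  "((\<lambda>h. lss_coord (\<mu>, \<sigma>, \<xi> + h) x) has_real_derivative
     - (if \<xi> = 0 then u\<^sup>2 / 2 else (t * ln t - t + 1) / (\<xi>\<^sup>2 * t))) (at 0)"
proof (cases "\<xi> = 0")
  case True
  then show ?thesis
    using DERIV_ln_one_plus_mult_over[of u] unfolding u_def by simp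
next
  case False
  have "((\<lambda>h. 1 + (\<xi> + h) * u) has_real_derivative u) (at 0)"
    by (auto intro!: derivative_eq_intros)
  then have "((\<lambda>h. ln (1 + (\<xi> + h) * u)) has_real_derivative u / t) (at 0)"
    using DERIV_chain2[OF DERIV_ln_divide, of "\<lambda>h. 1 + (\<xi> + h) * u" 0 u] t by (simp add: t_def)
  then have "((\<lambda>h. ln (1 + (\<xi> + h) * u) / (\<xi> + h)) has_real_derivative
      (u / t * \<xi> - ln t) / (\<xi> * \<xi>)) (at 0)"
    using False t by (auto simp: t_def intro!: derivative_eq_intros)
  also have "(u / t * \<xi> - ln t) / (\<xi> * \<xi>) = - ((t * ln t - t + 1) / (\<xi>\<^sup>2 * t))"
  proof -
    have "u = (t - 1) / \<xi>"
      using False by (simp add: t_def)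
    then show ?thesis
      using False t by (simp add: field_simps power2_eq_square)
  qed
  finally have "((\<lambda>h. ln (1 + (\<xi> + h) * u) / (\<xi> + h)) has_real_derivative
      - ((t * ln t - t + 1) / (\<xi>\<^sup>2 * t))) (at 0)" .
  \<comment> \<open>Only h = -\<xi> would reach the other branch of the definition, and it stays
    away from 0.\<close>
  moreover have "\<forall>\<^sub>F h in nhds 0. lss_coord (\<mu>, \<sigma>, \<xi> + h) x = ln (1 + (\<xi> + h) * u) / (\<xi> + h)"
  proof -
    have "\<forall>\<^sub>F h in nhds 0. h \<noteq> - \<xi>"
      using False by (intro t1_space_nhds) auto
    then show ?thesis
      by eventually_elim (auto simp: u_def)
  qed
  ultimately show ?thesis
    using False by (subst DERIV_cong_ev[OF refl _ refl]) auto
qed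

text \<open>The reciprocal of the slope is \<sigma> + \<xi>(x - \<mu>), affine in each parameter
  with derivatives -\<xi>, 1 and \<sigma>u in \<mu>, \<sigma> and \<xi>. This gives the numerators
  here and in the next two lemmas.\<close>

lemma DERIV_lss_slope_location:
  "((\<lambda>h. lss_slope (\<mu> + h, \<sigma>, \<xi>) x) has_real_derivative \<xi> / (\<sigma> * t)\<^sup>2) (at 0)"
proof -
  have "((\<lambda>h. \<sigma> * (1 + \<xi> * ((x - (\<mu> + h)) / \<sigma>))) has_real_derivative - \<xi>) (at 0)"
    using \<sigma> by (auto intro!: derivative_eq_intros)
  from DERIV_inverse_fun[OF this] show ?thesis
    using t \<sigma> by (simp add: t_def u_def power2_eq_square divide_inverse)
qed

lemma DERIV_lss_slope_scale:
  "((\<lambda>h. lss_slope (\<mu>, \<sigma> + h, \<xi>) x) has_real_derivative - (1 / (\<sigma> * t)\<^sup>2)) (at 0)"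
proof -
  have "((\<lambda>h. (\<sigma> + h) * (1 + \<xi> * ((x - \<mu>) / (\<sigma> + h)))) has_real_derivative 1) (at 0)"
    using \<sigma> by (auto intro!: derivative_eq_intros simp: field_simps)
  from DERIV_inverse_fun[OF this] show ?thesis
    using t \<sigma> by (simp add: t_def u_def power2_eq_square divide_inverse)
qed

lemma DERIV_lss_slope_shape:
  "((\<lambda>h. lss_slope (\<mu>, \<sigma>, \<xi> + h) x) has_real_derivative - (\<sigma> * u / (\<sigma> * t)\<^sup>2)) (at 0)"
proof -
  have "((\<lambda>h. \<sigma> * (1 + (\<xi> + h) * ((x - \<mu>) / \<sigma>))) has_real_derivative \<sigma> * u) (at 0)"
    by (auto intro!: derivative_eq_intros simp: u_def)
  from DERIV_inverse_fun[OF this] show ?thesis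
    using t \<sigma> by (simp add: t_def u_def power2_eq_square divide_inverse)
qed

lemma DERIV_lss_slope: "(lss_slope (\<mu>, \<sigma>, \<xi>) has_real_derivative - (\<xi> / (\<sigma> * t)\<^sup>2)) (at x)"
proof -
  have "((\<lambda>y. \<sigma> * (1 + \<xi> * ((y - \<mu>) / \<sigma>))) has_real_derivative \<xi>) (at x)"
    using \<sigma> by (auto intro!: derivative_eq_intros)
  from DERIV_inverse_fun[OF this] show ?thesis
    using t \<sigma> by (simp add: t_def u_def power2_eq_square divide_inverse lss_slope.simps[abs_def])
qed

lemma DERIV_lss_flux_scale:
  "((\<lambda>y. (y - \<mu>) / \<sigma> * lss_slope (\<mu>, \<sigma>, \<xi>) y) has_real_derivative 1 / (\<sigma> * t)\<^sup>2) (at x)"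
proof (rule DERIV_cong[OF DERIV_mult[OF DERIV_cdivide[OF DERIV_diff[OF DERIV_ident DERIV_const]] DERIV_lss_slope]])
  \<comment> \<open>The numerator collapses because t - \<xi>u = 1 by the definition of t.\<close>
  have "1 / \<sigma> * (1 / (\<sigma> * t)) - \<xi> * u / (\<sigma> * t)\<^sup>2 = (t - \<xi> * u) / (\<sigma> * t)\<^sup>2"
    using \<sigma> t by (simp add: power2_eq_square diff_divide_distrib)
  then show "(1 - 0) / \<sigma> * lss_slope (\<mu>, \<sigma>, \<xi>) x + - (\<xi> / (\<sigma> * t)\<^sup>2) * ((x - \<mu>) / \<sigma>) = 1 / (\<sigma> * t)\<^sup>2"
    by (simp add: t_def flip: u_def)
qed

end

text \<open>The derivative of t ln t - t + 1 is t' ln t, so the logarithms cancel in the product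
  rule and t - 1 = \<xi>u remains. The result is minus the shape derivative of the slope.\<close>

lemma DERIV_lss_flux_shape:
  fixes \<mu> \<sigma> \<xi> x :: real
  defines "u \<equiv> \<lambda>y. (y - \<mu>) / \<sigma>" and "t \<equiv> \<lambda>y. 1 + \<xi> * ((y - \<mu>) / \<sigma>)"
  assumes \<sigma>: "0 < \<sigma>" and t: "0 < t x"
  shows "((\<lambda>y. (if \<xi> = 0 then \<sigma> / 2 * (u y)\<^sup>2 else \<sigma> / \<xi>\<^sup>2 * (t y * ln (t y) - t y + 1))
      * lss_slope (\<mu>, \<sigma>, \<xi>) y) has_real_derivative \<sigma> * u x / (\<sigma> * t x)\<^sup>2) (at x)"
proof (cases "\<xi> = 0")
  case True
  have "(u has_real_derivative 1 / \<sigma>) (at x)"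
    unfolding u_def using \<sigma> by (auto intro!: derivative_eq_intros)
  then have "((\<lambda>y. (u y)\<^sup>2 / 2) has_real_derivative u x / \<sigma>) (at x)"
    by (auto intro!: derivative_eq_intros)
  with True \<sigma> show ?thesis
    by (simp add: t_def power2_eq_square)
next
  case False
  have "(t has_real_derivative \<xi> / \<sigma>) (at x)"
    unfolding t_def using \<sigma> by (auto intro!: derivative_eq_intros)
  then have D: "((\<lambda>y. t y * ln (t y) - t y + 1) has_real_derivative \<xi> / \<sigma> * ln (t x)) (at x)"
    using t by (auto intro!: derivative_eq_intros)
  have tx: "1 + \<xi> * ((x - \<mu>) / \<sigma>) = t x"
    by (simp add: t_def)
  have u: "u x = (t x - 1) / \<xi>"
    using False by (simp add: t_def u_def)
  have "\<sigma> / \<xi>\<^sup>2 * (\<xi> / \<sigma> * ln (t x)) * lss_slope (\<mu>, \<sigma>, \<xi>) x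
      + - (\<xi> / (\<sigma> * (1 + \<xi> * ((x - \<mu>) / \<sigma>)))\<^sup>2) * (\<sigma> / \<xi>\<^sup>2 * (t x * ln (t x) - t x + 1))
      = \<sigma> * u x / (\<sigma> * t x)\<^sup>2"
    unfolding lss_slope.simps tx u
    using \<sigma> t False by (simp add: field_simps power2_eq_square)
  from DERIV_cong[OF DERIV_mult[OF DERIV_cmult[OF D] DERIV_lss_slope[OF \<sigma> t[unfolded t_def]]] this]
  show ?thesis
    unfolding if_not_P[OF False] .
qed

subsection \<open>The score functions\<close>

theorem theorem1:
  fixes f :: "real \<Rightarrow> real" and \<Xi> :: "real set" and \<mu> \<sigma> \<xi> :: real
  assumes "open \<Xi>" and "0 \<in> \<Xi>"
    and "C_k 4 f" and "prob_density_fun f"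
    and "\<forall>t \<in> (\<lambda>s. 2 * s) ` \<Xi>. integrable lborel (\<lambda>z. exp (t * z) * f z)"
    and "\<sigma> > 0" and "\<xi> \<in> \<Xi>"
  defines "P \<equiv> law (lss_density f (\<mu>, \<sigma>, \<xi>))"
    and "t \<equiv> (\<lambda>x. 1 + \<xi> * ((x - \<mu>) / \<sigma>))"
  shows "is_wasserstein_score (lss_density f) (lss_support (\<mu>, \<sigma>, \<xi>)) (\<mu>, \<sigma>, \<xi>) (1, 0, 0)
           (\<lambda>x. x - prob_space.expectation P (\<lambda>y. y))
       \<and> is_wasserstein_score (lss_density f) (lss_support (\<mu>, \<sigma>, \<xi>)) (\<mu>, \<sigma>, \<xi>) (0, 1, 0)
           (\<lambda>x. (x - \<mu>)\<^sup>2 / (2 * \<sigma>)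
              - (prob_space.variance P (\<lambda>y. y) + (prob_space.expectation P (\<lambda>y. y) - \<mu>)\<^sup>2) / (2 * \<sigma>))
       \<and> is_wasserstein_score (lss_density f) (lss_support (\<mu>, \<sigma>, \<xi>)) (\<mu>, \<sigma>, \<xi>) (0, 0, 1)
           (\<lambda>x. if \<xi> \<noteq> 0
              then \<sigma>\<^sup>2 / \<xi> ^ 3 * (1 / 2 * (t x)\<^sup>2 * ln (t x) - 3 / 4 * (t x)\<^sup>2 + t x
                     - \<xi> / 2 * deriv (mgf f) (2 * \<xi>) + 3 / 4 * mgf f (2 * \<xi>) - mgf f \<xi>)
              else \<sigma>\<^sup>2 / 6 * (((x - \<mu>) / \<sigma>) ^ 3 - (deriv ^^ 3) (mgf f) 0))"
proof -
  let ?\<theta> = "(\<mu>, \<sigma>, \<xi>)"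
  let ?Q = "lss_quantile ?\<theta>" and ?p = "lss_density f ?\<theta>" and ?D = "lss_support ?\<theta>"
  have \<sigma>: "0 < fst (snd ?\<theta>)" "0 < \<sigma>" "\<sigma> \<noteq> 0"
    using \<open>\<sigma> > 0\<close> by auto
  have f: "0 \<le> f z" "integrable lborel f" "(LINT z|lborel. f z) = 1" for z
    using \<open>prob_density_fun f\<close> by (auto simp: prob_density_fun_def)
  have f': "(f has_real_derivative deriv f z) (at z)" for z
    using \<open>C_k 4 f\<close> field_differentiable_derivI[of f z] unfolding C_k_def by fastforce
  have [measurable]: "f \<in> borel_measurable borel"
    using borel_measurable_integrable[OF f(2)] by simp

  let ?S = "(\<lambda>s. 2 * s) ` \<Xi>"
  have S: "open ?S" "0 \<in> ?S" "2 * \<xi> \<in> ?S"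
    using open_scaling[of 2 \<Xi>] assms(1,2,7) by auto
  have mgf: "integrable lborel (\<lambda>z. exp (s * z) * (z ^ k * f z))"
    "(deriv ^^ k) (mgf f) s = mgf (\<lambda>z. z ^ k * f z) s" if "s \<in> ?S" for s k
    using higher_deriv_mgf[OF S(1) _ that, of f k] assms(5) by auto
  have exp_double: "exp (2 * \<xi> * z) = (exp (\<xi> * z))\<^sup>2" for z
    by (simp add: power2_eq_square mult_exp_exp)
  have exp2: "integrable lborel (\<lambda>z. exp (2 * \<xi> * z) * f z)"
    using mgf(1)[OF S(3), of 0] by simp
  \<comment> \<open>The point \<xi> need not lie in 2\<Xi>, so this tilt is bounded by those at 0
    and 2\<xi>, using exp y \<le> 1 + exp(2y).\<close>
  have exp1: "integrable lborel (\<lambda>z. exp (\<xi> * z) * f z)"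
  proof (rule Bochner_Integration.integrable_bound)
    show "integrable lborel (\<lambda>z. f z + exp (2 * \<xi> * z) * f z)"
      using f(2) exp2 by (rule Bochner_Integration.integrable_add)
    have "exp y \<le> 1 + exp (2 * y)" for y :: real
      by (cases "y \<ge> 0") (auto intro: add_increasing add_increasing2)
    from mult_right_mono[OF this f(1)]
    show "AE z in lborel. norm (exp (\<xi> * z) * f z) \<le> norm (f z + exp (2 * \<xi> * z) * f z)"
      using f(1) by (auto simp: ring_distribs mult.assoc)
  qed measurable

  have int_Q: "integrable lborel (\<lambda>z. (?Q z - \<mu>) * f z)"
  proof (cases "\<xi> = 0")
    case True
    have "integrable lborel (\<lambda>z. \<sigma> * (z * f z))"
      using mgf(1)[OF S(2), of 1] by (intro integrable_mult_right) simp
    with True show ?thesis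
      by (simp add: mult.assoc)
  next
    case False
    have "(\<lambda>z. (?Q z - \<mu>) * f z) = (\<lambda>z. \<sigma> / \<xi> * (exp (\<xi> * z) * f z - f z))"
      using False by (auto simp: field_simps)
    then show ?thesis
      using exp1 f(2) by (auto intro!: integrable_mult_right Bochner_Integration.integrable_diff)
  qed
  \<comment> \<open>For \<xi> \<noteq> 0 the square expands into tilts at 0, \<xi> and 2\<xi>, which
    is where the moment generating function at 2\<xi> enters; for \<xi> = 0 it is a second moment of
    \<open>f\<close>.\<close>
  have int_Q2: "integrable lborel (\<lambda>z. (?Q z - \<mu>)\<^sup>2 * f z)"
  proof (cases "\<xi> = 0")
    case True
    have "integrable lborel (\<lambda>z. \<sigma>\<^sup>2 * (z\<^sup>2 * f z))"
      using mgf(1)[OF S(2), of 2] by (intro integrable_mult_right) simp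
    with True show ?thesis
      by (simp add: power_mult_distrib mult.assoc)
  next
    case False
    have "(\<lambda>z. (?Q z - \<mu>)\<^sup>2 * f z) =
        (\<lambda>z. (\<sigma> / \<xi>)\<^sup>2 * (exp (2 * \<xi> * z) * f z - 2 * (exp (\<xi> * z) * f z) + f z))"
      unfolding exp_double using False by (auto simp: field_simps power2_eq_square)
    then show ?thesis
      using exp1 exp2 f(2)
      by (auto intro!: integrable_mult_right Bochner_Integration.integrable_diff
          Bochner_Integration.integrable_add)
  qed

  \<comment> \<open>Moments are taken about \<mu> rather than about the mean: \<open>v\<close> is
    then the variance plus the squared distance from the mean to \<mu>, the constant of the scale
    score.\<close>
  define e where "e = (LINT z|lborel. (?Q z - \<mu>) * f z)"
  define v where "v = (LINT z|lborel. (?Q z - \<mu>)\<^sup>2 * f z)"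
  have E: "integral\<^sup>L P (\<lambda>y. y) = \<mu> + e"
  proof -
    have eq: "(\<lambda>z. ?Q z * f z) = (\<lambda>z. \<mu> * f z + (?Q z - \<mu>) * f z)"
      by (auto simp: algebra_simps)
    have "integrable lborel (\<lambda>z. ?Q z * f z)"
      unfolding eq using f(2) int_Q
      by (intro Bochner_Integration.integrable_add integrable_mult_right)
    then have "integral\<^sup>L P (\<lambda>y. y) = (LINT z|lborel. ?Q z * f z)"
      unfolding P_def by (intro integral_law_lss \<sigma> f) auto
    then show ?thesis
      unfolding eq using f int_Q by (simp add: e_def del: lss_quantile.simps)
  qed
  have V: "(LINT y|P. (y - (\<mu> + e))\<^sup>2) + e\<^sup>2 = v"
  proof -
    have eq: "(\<lambda>z. (?Q z - (\<mu> + e))\<^sup>2 * f z)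
        = (\<lambda>z. (?Q z - \<mu>)\<^sup>2 * f z - 2 * e * ((?Q z - \<mu>) * f z) + e\<^sup>2 * f z)"
      by (auto simp: algebra_simps power2_eq_square)
    have "integrable lborel (\<lambda>z. (?Q z - (\<mu> + e))\<^sup>2 * f z)"
      unfolding eq using f(2) int_Q int_Q2
      by (intro Bochner_Integration.integrable_add Bochner_Integration.integrable_diff
          integrable_mult_right)
    then have "(LINT y|P. (y - (\<mu> + e))\<^sup>2) = (LINT z|lborel. (?Q z - (\<mu> + e))\<^sup>2 * f z)"
      unfolding P_def by (intro integral_law_lss \<sigma> f) auto
    also have "\<dots> = v - 2 * e * e + e\<^sup>2"
      unfolding eq using f int_Q int_Q2 by (simp add: e_def v_def del: lss_quantile.simps)
    finally show ?thesis
      by (simp add: power2_eq_square)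
  qed

  have t_pos: "0 < t x" if "x \<in> ?D" for x
    using that by (simp add: t_def)
  have slope: "lss_slope ?\<theta> x = 1 / (\<sigma> * t x)" if "x \<in> ?D" for x
    by (simp add: t_def)

  have "is_wasserstein_score (lss_density f) ?D ?\<theta> (1, 0, 0) (\<lambda>x. x - (\<mu> + e))"
  proof (rule is_wasserstein_score_lss[where V = "\<lambda>x. 1" and m = "\<lambda>x. - (\<xi> / (\<sigma> * t x)\<^sup>2)",
        OF \<sigma>(1) f(1) f'])
    fix x assume x: "x \<in> ?D"
    show "((\<lambda>h. lss_coord (?\<theta> + h *\<^sub>R (1, 0, 0)) x) has_real_derivative - (1 * lss_slope ?\<theta> x)) (at 0)"
      using DERIV_lss_coord_location[of \<sigma> \<xi> x \<mu>] \<sigma> t_pos[OF x] slope[OF x]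
      by (simp add: t_def del: lss_coord.simps lss_slope.simps)
    show "((\<lambda>h. lss_slope (?\<theta> + h *\<^sub>R (1, 0, 0)) x) has_real_derivative
        - (- (\<xi> / (\<sigma> * t x)\<^sup>2))) (at 0)"
      using DERIV_lss_slope_location[of \<sigma> \<xi> x \<mu>] \<sigma> t_pos[OF x]
      by (simp add: t_def del: lss_coord.simps lss_slope.simps)
    show "((\<lambda>y. 1 * lss_slope ?\<theta> y) has_real_derivative - (\<xi> / (\<sigma> * t x)\<^sup>2)) (at x)"
      using DERIV_lss_slope[of \<sigma> \<xi> x \<mu>] \<sigma> t_pos[OF x]
      by (simp add: t_def del: lss_coord.simps lss_slope.simps)
    show "((\<lambda>x. x - (\<mu> + e)) has_real_derivative 1) (at x)"
      by (auto intro!: derivative_eq_intros)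
  next
    \<comment> \<open>The value is e - e * 1, with 1 the total mass of \<open>f\<close>; the
      centering constants of the other two scores cancel in the same way.\<close>
    have "has_bochner_integral lborel (\<lambda>z. (?Q z - \<mu>) * f z - e * f z) (e - e * 1)"
      using f int_Q unfolding e_def
      by (intro has_bochner_integral_diff has_bochner_integral_mult_right)
        (auto simp: has_bochner_integral_iff simp del: lss_quantile.simps)
    then show "has_bochner_integral lborel (\<lambda>z. (?Q z - (\<mu> + e)) * f z) 0"
      by (simp add: algebra_simps del: lss_quantile.simps)
  qed measurable

  moreover have "is_wasserstein_score (lss_density f) ?D ?\<theta> (0, 1, 0)
    (\<lambda>x. (x - \<mu>)\<^sup>2 / (2 * \<sigma>) - v / (2 * \<sigma>))"
  proof (rule is_wasserstein_score_lss[where V = "\<lambda>x. (x - \<mu>) / \<sigma>" and m = "\<lambda>x. 1 / (\<sigma> * t x)\<^sup>2",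
        OF \<sigma>(1) f(1) f'])
    fix x assume x: "x \<in> ?D"
    show "((\<lambda>h. lss_coord (?\<theta> + h *\<^sub>R (0, 1, 0)) x) has_real_derivative
        - ((x - \<mu>) / \<sigma> * lss_slope ?\<theta> x)) (at 0)"
      using DERIV_lss_coord_scale[of \<sigma> \<xi> x \<mu>] \<sigma> t_pos[OF x] slope[OF x]
      by (simp add: t_def del: lss_coord.simps lss_slope.simps)
    show "((\<lambda>h. lss_slope (?\<theta> + h *\<^sub>R (0, 1, 0)) x) has_real_derivative
        - (1 / (\<sigma> * t x)\<^sup>2)) (at 0)"
      using DERIV_lss_slope_scale[of \<sigma> \<xi> x \<mu>] \<sigma> t_pos[OF x]
      by (simp add: t_def del: lss_coord.simps lss_slope.simps)
    show "((\<lambda>y. (y - \<mu>) / \<sigma> * lss_slope ?\<theta> y) has_real_derivative 1 / (\<sigma> * t x)\<^sup>2) (at x)"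
      using DERIV_lss_flux_scale[of \<sigma> \<xi> x \<mu>] \<sigma> t_pos[OF x]
      by (simp add: t_def del: lss_coord.simps lss_slope.simps)
    show "((\<lambda>x. (x - \<mu>)\<^sup>2 / (2 * \<sigma>) - v / (2 * \<sigma>)) has_real_derivative (x - \<mu>) / \<sigma>) (at x)"
      using \<sigma> by (auto intro!: derivative_eq_intros simp: field_simps)
  next
    have "has_bochner_integral lborel
      (\<lambda>z. 1 / (2 * \<sigma>) * ((?Q z - \<mu>)\<^sup>2 * f z - v * f z)) (1 / (2 * \<sigma>) * (v - v * 1))"
      using f int_Q2 unfolding v_def
      by (intro has_bochner_integral_diff has_bochner_integral_mult_right)
        (auto simp: has_bochner_integral_iff simp del: lss_quantile.simps)
    then show "has_bochner_integral lborel (\<lambda>z. ((?Q z - \<mu>)\<^sup>2 / (2 * \<sigma>) - v / (2 * \<sigma>)) * f z) 0"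
      by (simp add: left_diff_distrib diff_divide_distrib del: lss_quantile.simps)
  qed measurable

  moreover have "is_wasserstein_score (lss_density f) ?D ?\<theta> (0, 0, 1)
           (\<lambda>x. if \<xi> \<noteq> 0
              then \<sigma>\<^sup>2 / \<xi> ^ 3 * (1 / 2 * (t x)\<^sup>2 * ln (t x) - 3 / 4 * (t x)\<^sup>2 + t x
                     - \<xi> / 2 * deriv (mgf f) (2 * \<xi>) + 3 / 4 * mgf f (2 * \<xi>) - mgf f \<xi>)
              else \<sigma>\<^sup>2 / 6 * (((x - \<mu>) / \<sigma>) ^ 3 - (deriv ^^ 3) (mgf f) 0))"
    (is "is_wasserstein_score _ _ _ _ ?\<Phi>")
  \<comment> \<open>\<open>V\<close> is the \<xi>-derivative of Q expressed in x, with its limit at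
    \<xi> = 0, and \<open>m\<close> is minus the \<xi>-derivative of the slope.\<close>
  proof (rule is_wasserstein_score_lss[where m = "\<lambda>x. \<sigma> * ((x - \<mu>) / \<sigma>) / (\<sigma> * t x)\<^sup>2" and
        V = "\<lambda>x. if \<xi> = 0 then \<sigma> / 2 * ((x - \<mu>) / \<sigma>)\<^sup>2 else \<sigma> / \<xi>\<^sup>2 * (t x * ln (t x) - t x + 1)",
        OF \<sigma>(1) f(1) f'])
    fix x assume x: "x \<in> ?D"
    have "(if \<xi> = 0 then \<sigma> / 2 * ((x - \<mu>) / \<sigma>)\<^sup>2 else \<sigma> / \<xi>\<^sup>2 * (t x * ln (t x) - t x + 1))
        * lss_slope ?\<theta> x = (if \<xi> = 0 then ((x - \<mu>) / \<sigma>)\<^sup>2 / 2 else (t x * ln (t x) - t x + 1) / (\<xi>\<^sup>2 * t x))"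
      using \<sigma> t_pos[OF x] slope[OF x]
      by (auto simp: t_def power2_eq_square simp del: lss_coord.simps lss_slope.simps)
    then show "((\<lambda>h. lss_coord (?\<theta> + h *\<^sub>R (0, 0, 1)) x) has_real_derivative
        - ((if \<xi> = 0 then \<sigma> / 2 * ((x - \<mu>) / \<sigma>)\<^sup>2 else \<sigma> / \<xi>\<^sup>2 * (t x * ln (t x) - t x + 1))
          * lss_slope ?\<theta> x)) (at 0)"
      using DERIV_lss_coord_shape[of \<sigma> \<xi> x \<mu>] \<sigma> t_pos[OF x]
      by (simp only: t_def scaleR_Pair add_Pair real_scaleR_def mult_zero_right mult_1_right add_0_right)
    show "((\<lambda>h. lss_slope (?\<theta> + h *\<^sub>R (0, 0, 1)) x) has_real_derivative
        - (\<sigma> * ((x - \<mu>) / \<sigma>) / (\<sigma> * t x)\<^sup>2)) (at 0)"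
      using DERIV_lss_slope_shape[of \<sigma> \<xi> x \<mu>] \<sigma> t_pos[OF x]
      by (simp only: t_def scaleR_Pair add_Pair real_scaleR_def mult_zero_right mult_1_right add_0_right)
    show "((\<lambda>y. (if \<xi> = 0 then \<sigma> / 2 * ((y - \<mu>) / \<sigma>)\<^sup>2 else \<sigma> / \<xi>\<^sup>2 * (t y * ln (t y) - t y + 1))
        * lss_slope ?\<theta> y) has_real_derivative \<sigma> * ((x - \<mu>) / \<sigma>) / (\<sigma> * t x)\<^sup>2) (at x)"
      using DERIV_lss_flux_shape[of \<sigma> \<xi> x \<mu>] \<sigma> t_pos[OF x] unfolding t_def by blast
    show "(?\<Phi> has_real_derivative
        (if \<xi> = 0 then \<sigma> / 2 * ((x - \<mu>) / \<sigma>)\<^sup>2 else \<sigma> / \<xi>\<^sup>2 * (t x * ln (t x) - t x + 1))) (at x)"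
    proof (cases "\<xi> = 0")
      case True
      have "((\<lambda>x. \<sigma>\<^sup>2 / 6 * (((x - \<mu>) / \<sigma>) ^ 3 - (deriv ^^ 3) (mgf f) 0)) has_real_derivative
          \<sigma>\<^sup>2 / 6 * (3 * ((x - \<mu>) / \<sigma>)\<^sup>2 * (1 / \<sigma>))) (at x)"
        by (auto intro!: derivative_eq_intros \<sigma>)
      also have "\<sigma>\<^sup>2 / 6 * (3 * ((x - \<mu>) / \<sigma>)\<^sup>2 * (1 / \<sigma>)) = \<sigma> / 2 * ((x - \<mu>) / \<sigma>)\<^sup>2"
        using \<sigma> by (simp add: power2_eq_square)
      finally show ?thesis
        using True by simp
    next
      case False
      have "(t has_real_derivative \<xi> / \<sigma>) (at x)"
        unfolding t_def using \<sigma> by (auto intro!: derivative_eq_intros)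
      \<comment> \<open>The polynomial-logarithmic part is a primitive in t of t ln t - t + 1, and
        t' = \<xi>/\<sigma>.\<close>
      then have "((\<lambda>x. 1 / 2 * (t x)\<^sup>2 * ln (t x) - 3 / 4 * (t x)\<^sup>2 + t x
          - \<xi> / 2 * deriv (mgf f) (2 * \<xi>) + 3 / 4 * mgf f (2 * \<xi>) - mgf f \<xi>) has_real_derivative
          \<xi> / \<sigma> * (t x * ln (t x) - t x + 1)) (at x)"
        using t_pos[OF x] \<sigma> by (auto intro!: derivative_eq_intros simp: field_simps power2_eq_square)
      then have "((\<lambda>x. \<sigma>\<^sup>2 / \<xi> ^ 3 * (1 / 2 * (t x)\<^sup>2 * ln (t x) - 3 / 4 * (t x)\<^sup>2 + t x
          - \<xi> / 2 * deriv (mgf f) (2 * \<xi>) + 3 / 4 * mgf f (2 * \<xi>) - mgf f \<xi>)) has_real_derivative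
          \<sigma>\<^sup>2 / \<xi> ^ 3 * (\<xi> / \<sigma> * (t x * ln (t x) - t x + 1))) (at x)"
        by (rule DERIV_cmult)
      also have "\<sigma>\<^sup>2 / \<xi> ^ 3 * (\<xi> / \<sigma> * (t x * ln (t x) - t x + 1))
          = \<sigma> / \<xi>\<^sup>2 * (t x * ln (t x) - t x + 1)"
        using \<sigma> False by (simp add: power2_eq_square power3_eq_cube)
      finally show ?thesis
        using False by simp
    qed
  next
    show "?\<Phi> \<in> borel_measurable borel"
      unfolding t_def by measurable
    show "has_bochner_integral lborel (\<lambda>z. ?\<Phi> (?Q z) * f z) 0"
    proof (cases "\<xi> = 0")
      case True
      let ?c = "(deriv ^^ 3) (mgf f) 0"
      have "has_bochner_integral lborel (\<lambda>z. \<sigma>\<^sup>2 / 6 * (z ^ 3 * f z - ?c * f z)) (\<sigma>\<^sup>2 / 6 * (?c - ?c * 1))"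
        using f mgf[OF S(2), of 3]
        by (intro has_bochner_integral_diff has_bochner_integral_mult_right)
          (auto simp: has_bochner_integral_iff mgf_def)
      with True \<sigma> show ?thesis
        by (simp add: left_diff_distrib mult.assoc)
    next
      case False
      have M: "deriv (mgf f) (2 * \<xi>) = (LINT z|lborel. exp (2 * \<xi> * z) * (z * f z))"
        and int_M: "integrable lborel (\<lambda>z. exp (2 * \<xi> * z) * (z * f z))"
        using mgf[OF S(3), of 1] by (auto simp: mgf_def)
      \<comment> \<open>At x = Q(z) one has t = exp(\<xi>z) and ln t = \<xi>z. The terms in t^2 ln
        t, t^2 and t thus integrate against \<open>f\<close> to multiples of M'(2\<xi>), M(2\<xi>)
        and M(\<xi>), and \<open>?c\<close> is their sum.\<close>
      let ?c = "\<xi> / 2 * deriv (mgf f) (2 * \<xi>) - 3 / 4 * mgf f (2 * \<xi>) + mgf f \<xi>"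
      have "has_bochner_integral lborel (\<lambda>z. \<sigma>\<^sup>2 / \<xi> ^ 3 * (\<xi> / 2 * (exp (2 * \<xi> * z) * (z * f z))
          - 3 / 4 * (exp (2 * \<xi> * z) * f z) + exp (\<xi> * z) * f z - ?c * f z)) (\<sigma>\<^sup>2 / \<xi> ^ 3 * (?c - ?c * 1))"
        unfolding mgf_def[of f "2 * \<xi>"] mgf_def[of f \<xi>] M using f exp1 exp2 int_M
        by (intro has_bochner_integral_diff has_bochner_integral_add has_bochner_integral_mult_right)
          (auto simp: has_bochner_integral_iff)
      moreover have "\<sigma>\<^sup>2 / \<xi> ^ 3 * (\<xi> / 2 * (exp (2 * \<xi> * z) * (z * f z))
          - 3 / 4 * (exp (2 * \<xi> * z) * f z) + exp (\<xi> * z) * f z - ?c * f z) = ?\<Phi> (?Q z) * f z" for z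
      proof -
        have "t (?Q z) = exp (\<xi> * z)"
          using False \<sigma> by (simp add: t_def)
        then show ?thesis
          using False by (simp only: exp_double if_True not_False_eq_True ln_exp) (simp add: algebra_simps)
      qed
      ultimately show ?thesis
        by (simp only: mult_1_right diff_self mult_zero_right)
    qed
  qed
  ultimately show ?thesis
    by (simp only: E add_diff_cancel_left' V)
qed

end
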